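(* Let $k\ge 2$ and let $G = PSL(2,2^k)$ be the projective special linear group over the field with $2^k$ elements. Then $$\text{L-Spec}(\Gamma_G)=\{0^{2^{2k}+2^k+1},\ (2^k-1)^{2^{2k}-2^k-2},\ (2^k-2)^{2^{k-1}(2^{2k}-2^{k+1}-3)},\ (2^k)^{2^{k-1}(2^{2k}-2^{k+1}+1)}\}$$ and $$\begin{aligned}\text{Q-Spec}(\Gamma_G)=\{&(2^{k+1}-4)^{2^k+1},\ (2^k-3)^{2^{2k}-2^k-2},\ (2^{k+1}-6)^{2^{k-1}(2^k+1)},\ (2^k-4)^{2^{k-1}(2^{2k}-2^{k+1}-3)},\\ &(2^{k+1}-2)^{2^{k-1}(2^k-1)},\ (2^k-2)^{2^{k-1}(2^{2k}-2^{k+1}+1)}\}.\end{aligned}$$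
   Context: The commuting graph $\Gamma_G$ of a finite non-abelian group $G$ with center $Z(G)$ is the simple undirected graph with vertex set $G\setminus Z(G)$ in which two distinct vertices $x,y$ are adjacent if and only if $xy=yx$. For a finite graph $\mathcal{G}$ with adjacency matrix $A$ and (diagonal) degree matrix $D$, $\text{L-Spec}(\mathcal{G})$ and $\text{Q-Spec}(\mathcal{G})$ denote the multisets of eigenvalues (with multiplicity) of the Laplacian matrix $D-A$ and of the signless Laplacian matrix $D+A$, respectively. The notation $\{\alpha_1^{a_1},\dots,\alpha_l^{a_l}\}$ means the multiset in which $\alpha_i$ is listed $a_i$ times (the outermost exponent is the multiplicity; if listed values coincide, their multiplicities add; an exponent $0$ means the value does not appear). *)

theory Defs
  imports
    "HOL-Algebra.Coset"
    "HOL-Computational_Algebra.Polynomial"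
    "Jordan_Normal_Form.Determinant"
    "Jordan_Normal_Form.Char_Poly"
    "Graph_Theory.Pair_Digraph"
begin

definition center :: "('a, 'b) monoid_scheme \<Rightarrow> 'a set" where
  "center G = {z \<in> carrier G. \<forall>x \<in> carrier G. z \<otimes>\<^bsub>G\<^esub> x = x \<otimes>\<^bsub>G\<^esub> z}"

definition special_linear :: "'a :: comm_ring_1 itself \<Rightarrow> nat \<Rightarrow> 'a mat monoid" where
  "special_linear T n =
     \<lparr>carrier = {A \<in> carrier_mat n n. det A = 1}, monoid.mult = (*), one = 1\<^sub>m n\<rparr>"

definition PSL :: "'a :: comm_ring_1 itself \<Rightarrow> nat \<Rightarrow> 'a mat set monoid" where
  "PSL T n = special_linear T n Mod center (special_linear T n)"

lemma group_special_linear: "group (special_linear TYPE('a :: field) n)"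
proof (rule groupI)
  fix A assume "A \<in> carrier (special_linear TYPE('a) n)"
  then have A: "A \<in> carrier_mat n n" and d: "det A = 1"
    by (auto simp: special_linear_def)
  from det_non_zero_imp_unit[OF A, of "()"] d
  obtain B where B: "B \<in> carrier_mat n n" and BA: "B * A = 1\<^sub>m n"
    unfolding Units_def ring_mat_def by auto
  from det_mult[OF B A] BA d have "det B = 1"
    by simp
  then show "\<exists>y \<in> carrier (special_linear TYPE('a) n).
      y \<otimes>\<^bsub>special_linear TYPE('a) n\<^esub> A = \<one>\<^bsub>special_linear TYPE('a) n\<^esub>"
    using B BA by (auto simp: special_linear_def)
qed (auto simp: special_linear_def det_mult)

lemma (in group) center_normal: "center G \<lhd> G"
proof -
  have inv_center: "inv z \<otimes> x = x \<otimes> inv z"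
    if z: "z \<in> carrier G" "\<forall>x \<in> carrier G. z \<otimes> x = x \<otimes> z" and x: "x \<in> carrier G" for z x
  proof -
    have "x \<otimes> inv z = inv z \<otimes> (z \<otimes> x) \<otimes> inv z"
      using z(1) x by (simp add: m_assoc [symmetric])
    also have "\<dots> = inv z \<otimes> (x \<otimes> z) \<otimes> inv z"
      by (simp only: z(2)[rule_format, OF x])
    also have "\<dots> = inv z \<otimes> x"
      using z(1) x by (simp add: m_assoc)
    finally show ?thesis by simp
  qed
  have "subgroup (center G) G"
  proof (rule subgroupI)
    show "center G \<noteq> {}" using one_closed by (force simp: center_def)
  next
    show "center G \<subseteq> carrier G" by (auto simp: center_def)
  next
    fix a assume "a \<in> center G"
    then show "inv a \<in> center G" unfolding center_def using inv_center by blast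
  next
    fix a b assume ab: "a \<in> center G" "b \<in> center G"
    have "a \<otimes> b \<otimes> x = x \<otimes> (a \<otimes> b)" if x: "x \<in> carrier G" for x
    proof -
      have ca: "a \<in> carrier G" "a \<otimes> x = x \<otimes> a" and cb: "b \<in> carrier G" "b \<otimes> x = x \<otimes> b"
        using ab x unfolding center_def by blast+
      have "a \<otimes> b \<otimes> x = a \<otimes> (x \<otimes> b)" by (simp only: m_assoc[OF ca(1) cb(1) x] cb(2))
      also have "\<dots> = x \<otimes> (a \<otimes> b)"
        by (simp only: m_assoc[OF ca(1) x cb(1), symmetric] ca(2) m_assoc[OF x ca(1) cb(1)])
      finally show ?thesis .
    qed
    with ab show "a \<otimes> b \<in> center G"
      unfolding center_def by blast
  qed
  moreover have "x \<otimes> h \<otimes> inv x \<in> center G" if x: "x \<in> carrier G" and h: "h \<in> center G" for x h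
  proof -
    have h': "h \<in> carrier G" "h \<otimes> x = x \<otimes> h" using x h unfolding center_def by blast+
    have "x \<otimes> h \<otimes> inv x = h" unfolding h'(2)[symmetric] using x h'(1) by (simp add: m_assoc)
    with h show ?thesis by simp
  qed
  ultimately show ?thesis by (simp add: normal_inv_iff)
qed

lemma group_PSL: "group (PSL TYPE('a :: field) n)"
  unfolding PSL_def
  by (intro normal.factorgroup_is_group group.center_normal group_special_linear)

text \<open>A simple undirected graph is represented as a symmetric loop-free digraph
  (\<^locale>\<open>pair_graph\<close>): an edge between \<open>x\<close> and \<open>y\<close> is the pair of arcs
  \<open>(x, y)\<close> and \<open>(y, x)\<close>.\<close>

definition commuting_graph :: "('a, 'b) monoid_scheme \<Rightarrow> 'a pair_pre_digraph" where
  "commuting_graph G =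
     \<lparr>pverts = carrier G - center G,
      parcs = {(x, y). x \<in> carrier G - center G \<and> y \<in> carrier G - center G \<and>
                       x \<noteq> y \<and> x \<otimes>\<^bsub>G\<^esub> y = y \<otimes>\<^bsub>G\<^esub> x}\<rparr>"

lemma pair_graph_commuting_graph:
  assumes "finite (carrier G)"
  shows "pair_graph (commuting_graph G)"
proof
  have "parcs (commuting_graph G) \<subseteq> carrier G \<times> carrier G"
    by (auto simp: commuting_graph_def)
  then show "finite (parcs (commuting_graph G))"
    using assms finite_subset by blast
  show "symmetric (with_proj (commuting_graph G))"
    by (auto simp: symmetric_def sym_def commuting_graph_def)
qed (use assms in \<open>auto simp: commuting_graph_def\<close>)

text \<open>The rows and columns of the matrices of a graph are indexed by the positions of a
  list \<open>vs\<close> that enumerates the vertices.\<close>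

definition adjacency_matrix :: "'v pair_pre_digraph \<Rightarrow> 'v list \<Rightarrow> complex mat" where
  "adjacency_matrix \<G> vs =
     mat (length vs) (length vs) (\<lambda>(i, j). if (vs ! i, vs ! j) \<in> parcs \<G> then 1 else 0)"

text \<open>In a symmetric digraph the out-degree is the degree of the undirected graph.\<close>

definition degree_matrix :: "'v pair_pre_digraph \<Rightarrow> 'v list \<Rightarrow> complex mat" where
  "degree_matrix \<G> vs =
     mat_diag (length vs) (\<lambda>i. of_nat (out_degree (with_proj \<G>) (vs ! i)))"

definition laplacian_matrix :: "'v pair_pre_digraph \<Rightarrow> 'v list \<Rightarrow> complex mat" where
  "laplacian_matrix \<G> vs = degree_matrix \<G> vs - adjacency_matrix \<G> vs"

definition signless_laplacian_matrix :: "'v pair_pre_digraph \<Rightarrow> 'v list \<Rightarrow> complex mat" where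
  "signless_laplacian_matrix \<G> vs = degree_matrix \<G> vs + adjacency_matrix \<G> vs"

text \<open>Algebraic multiplicities; working over the complex numbers, no root is lost.\<close>

definition eigenvalue_mset :: "complex mat \<Rightarrow> complex multiset" where
  "eigenvalue_mset M = proots (char_poly M)"

definition vertex_list :: "'v pair_pre_digraph \<Rightarrow> 'v list" where
  "vertex_list \<G> = (SOME vs. distinct vs \<and> set vs = pverts \<G>)"

text \<open>The choice of the enumeration does not matter; see \<open>L_spec_eq\<close> and \<open>Q_spec_eq\<close> below.\<close>

definition L_spec :: "'v pair_pre_digraph \<Rightarrow> complex multiset" where
  "L_spec \<G> = eigenvalue_mset (laplacian_matrix \<G> (vertex_list \<G>))"

definition Q_spec :: "'v pair_pre_digraph \<Rightarrow> complex multiset" where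
  "Q_spec \<G> = eigenvalue_mset (signless_laplacian_matrix \<G> (vertex_list \<G>))"

lemma char_poly_reindex:
  fixes f :: "'v \<Rightarrow> 'v \<Rightarrow> 'a :: comm_ring_1"
  assumes "distinct vs" "distinct ws" "set vs = set ws"
  shows "char_poly (mat (length vs) (length vs) (\<lambda>(i, j). f (vs ! i) (vs ! j))) =
         char_poly (mat (length ws) (length ws) (\<lambda>(i, j). f (ws ! i) (ws ! j)))"
    (is "char_poly ?A = char_poly ?B")
proof -
  define n where "n = length vs"
  have n: "length vs = n" "length ws = n"
    using assms by (metis distinct_card n_def)+
  define P :: "'a mat" where "P = mat n n (\<lambda>(i, j). if vs ! i = ws ! j then 1 else 0)"
  define Q :: "'a mat" where "Q = mat n n (\<lambda>(i, j). if ws ! i = vs ! j then 1 else 0)"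
  have ex: "\<exists>k < n. ys ! k = xs ! i"
    if "i < n" "set xs = set ys" "length xs = n" "length ys = n" for i and xs ys :: "'v list"
    using that by (metis in_set_conv_nth)
  have sum1: "(\<Sum>k = 0..<n. (if x = ys ! k then 1 else 0) * g k) = g j"
    if "distinct ys" "length ys = n" "j < n" "ys ! j = x" for x j and ys :: "'v list" and g :: "nat \<Rightarrow> 'a"
  proof -
    have "(\<Sum>k = 0..<n. (if x = ys ! k then 1 else 0) * g k) = (\<Sum>k = 0..<n. if k = j then g k else 0)"
      using that by (intro sum.cong) (auto simp: nth_eq_iff_index_eq)
    also have "\<dots> = g j" using that by simp
    finally show ?thesis .
  qed
  have sum2: "(\<Sum>k = 0..<n. g k * (if ys ! k = x then 1 else 0)) = g j"
    if "distinct ys" "length ys = n" "j < n" "ys ! j = x" for x j and ys :: "'v list" and g :: "nat \<Rightarrow> 'a"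
    unfolding sum1[OF that, of g, symmetric] by (intro sum.cong) auto
  have PQ: "P * Q = 1\<^sub>m n"
  proof (rule eq_matI)
    fix i j assume "i < dim_row (1\<^sub>m n :: 'a mat)" "j < dim_col (1\<^sub>m n :: 'a mat)"
    then have ij: "i < n" "j < n" by auto
    obtain k where k: "k < n" "ws ! k = vs ! i" using ex[of i vs ws] ij n assms by auto
    show "(P * Q) $$ (i, j) = 1\<^sub>m n $$ (i, j)"
      using ij sum1[of ws k "vs ! i" "\<lambda>l. if ws ! l = vs ! j then 1 else 0"] k n assms
      by (auto simp: P_def Q_def scalar_prod_def nth_eq_iff_index_eq)
  qed (auto simp: P_def Q_def)
  have QP: "Q * P = 1\<^sub>m n"
  proof (rule eq_matI)
    fix i j assume "i < dim_row (1\<^sub>m n :: 'a mat)" "j < dim_col (1\<^sub>m n :: 'a mat)"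
    then have ij: "i < n" "j < n" by auto
    obtain k where k: "k < n" "vs ! k = ws ! i" using ex[of i ws vs] ij n assms by auto
    show "(Q * P) $$ (i, j) = 1\<^sub>m n $$ (i, j)"
      using ij sum1[of vs k "ws ! i" "\<lambda>l. if vs ! l = ws ! j then 1 else 0"] k n assms
      by (auto simp: P_def Q_def scalar_prod_def nth_eq_iff_index_eq)
  qed (auto simp: P_def Q_def)
  have PB: "P * ?B = mat n n (\<lambda>(i, j). f (vs ! i) (ws ! j))"
  proof (rule eq_matI)
    fix i j assume "i < dim_row (mat n n (\<lambda>(i, j). f (vs ! i) (ws ! j)))"
      "j < dim_col (mat n n (\<lambda>(i, j). f (vs ! i) (ws ! j)))"
    then have ij: "i < n" "j < n" by auto
    obtain k where k: "k < n" "ws ! k = vs ! i" using ex[of i vs ws] ij n assms by auto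
    show "(P * ?B) $$ (i, j) = mat n n (\<lambda>(i, j). f (vs ! i) (ws ! j)) $$ (i, j)"
      using ij sum1[of ws k "vs ! i" "\<lambda>l. f (ws ! l) (ws ! j)"] k n assms
      by (auto simp: P_def scalar_prod_def)
  qed (auto simp: P_def n)
  have "?A = P * ?B * Q"
  proof (rule eq_matI)
    fix i j assume "i < dim_row (P * ?B * Q)" "j < dim_col (P * ?B * Q)"
    then have ij: "i < n" "j < n" by (auto simp: P_def Q_def)
    obtain k where k: "k < n" "ws ! k = vs ! j" using ex[of j vs ws] ij n assms by auto
    show "?A $$ (i, j) = (P * ?B * Q) $$ (i, j)"
      unfolding PB
      using ij sum2[of ws k "vs ! j" "\<lambda>l. f (vs ! i) (ws ! l)"] k n assms
      by (auto simp: Q_def scalar_prod_def)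
  qed (auto simp: P_def Q_def n)
  then have "similar_mat ?A ?B"
    using PQ QP by (intro similar_matI[of _ _ P Q n]) (auto simp: P_def Q_def n)
  then show ?thesis by (rule char_poly_similar)
qed

lemma vertex_list:
  assumes "finite (pverts \<G>)"
  shows "distinct (vertex_list \<G>)" "set (vertex_list \<G>) = pverts \<G>"
  using someI_ex[of "\<lambda>vs. distinct vs \<and> set vs = pverts \<G>"] finite_distinct_list[OF assms]
  unfolding vertex_list_def by blast+

lemma laplacian_matrix_conv:
  assumes "distinct vs"
  shows "laplacian_matrix \<G> vs = mat (length vs) (length vs) (\<lambda>(i, j).
      (\<lambda>x y. (if x = y then of_nat (out_degree (with_proj \<G>) x) else 0)
              - (if (x, y) \<in> parcs \<G> then 1 else 0)) (vs ! i) (vs ! j))"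
  using assms
  by (intro eq_matI) (auto simp: laplacian_matrix_def degree_matrix_def adjacency_matrix_def
      mat_diag_def nth_eq_iff_index_eq)

lemma signless_laplacian_matrix_conv:
  assumes "distinct vs"
  shows "signless_laplacian_matrix \<G> vs = mat (length vs) (length vs) (\<lambda>(i, j).
      (\<lambda>x y. (if x = y then of_nat (out_degree (with_proj \<G>) x) else 0)
              + (if (x, y) \<in> parcs \<G> then 1 else 0)) (vs ! i) (vs ! j))"
  using assms
  by (intro eq_matI) (auto simp: signless_laplacian_matrix_def degree_matrix_def
      adjacency_matrix_def mat_diag_def nth_eq_iff_index_eq)

lemma L_spec_eq:
  assumes "distinct vs" "set vs = pverts \<G>"
  shows "L_spec \<G> = eigenvalue_mset (laplacian_matrix \<G> vs)"
proof -
  have fin: "finite (pverts \<G>)" using assms by (metis List.finite_set)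
  show ?thesis
    unfolding L_spec_def eigenvalue_mset_def
      laplacian_matrix_conv[OF vertex_list(1)[OF fin]] laplacian_matrix_conv[OF assms(1)]
    by (rule arg_cong[of _ _ proots], rule char_poly_reindex) (use assms vertex_list[OF fin] in auto)
qed

lemma Q_spec_eq:
  assumes "distinct vs" "set vs = pverts \<G>"
  shows "Q_spec \<G> = eigenvalue_mset (signless_laplacian_matrix \<G> vs)"
proof -
  have fin: "finite (pverts \<G>)" using assms by (metis List.finite_set)
  show ?thesis
    unfolding Q_spec_def eigenvalue_mset_def
      signless_laplacian_matrix_conv[OF vertex_list(1)[OF fin]]
      signless_laplacian_matrix_conv[OF assms(1)]
    by (rule arg_cong[of _ _ proots], rule char_poly_reindex) (use assms vertex_list[OF fin] in auto)
qed

end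

theory Submission
  imports Defs
begin

text \<open>
  For even $q$ the centre of $SL(2,q)$ is trivial, so $PSL(2,q) = SL(2,q)$. Two non-scalar
  $2\times2$ matrices commute iff they agree up to a factor modulo the scalars, hence the commuting
  graph is a disjoint union of cliques indexed by the $q^2+q+1$ lines of matrices modulo scalars.
  As every element of the field is a square, the clique of the line of \<open>A\<close> is in bijection with the
  elements \<open>w\<close> such that $A + wI$ is invertible, so its size is \<open>q\<close> minus the number of roots of
  the characteristic polynomial of \<open>A\<close>. There are $q+1$ lines with a double root, $q(q+1)/2$ with
  two roots and $q(q-1)/2$ with none. The spectra are then read off from those of complete graphs.
\<close>

section \<open>Spectra of disjoint unions of cliques\<close>

lemma char_poly_clique:
  fixes a b :: "'a :: comm_ring_1"
  assumes "n > 0"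
  shows "char_poly (mat n n (\<lambda>(i, j). if i = j then a else b)) =
    [:- (a - b + of_nat n * b), 1:] * [:- (a - b), 1:] ^ (n - 1)"
proof -
  define A :: "'a mat" where "A = mat n n (\<lambda>(i, j). if i = j then a else b)"
  \<comment> \<open>The columns of \<open>P\<close> are the all-ones eigenvector and the unit vectors from the second on,
      so that conjugation by \<open>P\<close> makes the matrix upper triangular.\<close>
  define P :: "'a mat" where "P = mat n n (\<lambda>(i, j). if i = j \<or> j = 0 then 1 else 0)"
  \<comment> \<open>\<open>P\<close> minus the identity has square zero, so the inverse
    \<open>Q\<close> differs from \<open>P\<close> only in the sign of the off-diagonal
    entries.\<close>
  define Q :: "'a mat" where
    "Q = mat n n (\<lambda>(i, j). (if i = j then 1 else 0) - (if j = 0 \<and> i \<noteq> 0 then 1 else 0))"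
  define T :: "'a mat" where
    "T = mat n n (\<lambda>(i, j). if i = j then if i = 0 then a - b + of_nat n * b else a - b
                            else if i = 0 then b else 0)"
  have carr: "A \<in> carrier_mat n n" "P \<in> carrier_mat n n" "Q \<in> carrier_mat n n" "T \<in> carrier_mat n n"
    by (auto simp: A_def P_def Q_def T_def)
  have mult_index: "(X * Y) $$ (i, j) = (\<Sum>k = 0..<n. X $$ (i, k) * Y $$ (k, j))"
    if "i < n" "j < n" "X \<in> carrier_mat n n" "Y \<in> carrier_mat n n" for i j and X Y :: "'a mat"
    using that by (auto simp: scalar_prod_def)
  \<comment> \<open>Left multiplication by \<open>Q\<close> subtracts row 0 from every other row;
    dually, by \<open>sumP\<close> below, right multiplication by \<open>P\<close> replaces column 0
    by the sum of all columns.\<close>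
  have sumQ: "(\<Sum>k = 0..<n. Q $$ (i, k) * g k) = (if i = 0 then g 0 else g i - g 0)"
    if "i < n" for i g
  proof -
    have "(\<Sum>k = 0..<n. Q $$ (i, k) * g k) =
        (\<Sum>k = 0..<n. (if i = k then g k else 0) - (if k = 0 then if i \<noteq> 0 then g k else 0 else 0))"
      using that by (intro sum.cong) (auto simp: Q_def)
    then show ?thesis
      using that assms by (simp add: sum_subtractf)
  qed
  have sumP: "(\<Sum>k = 0..<n. g k * P $$ (k, j)) = (if j = 0 then \<Sum>k = 0..<n. g k else g j)"
    if "j < n" for j g
  proof -
    have "(\<Sum>k = 0..<n. g k * P $$ (k, j)) =
        (\<Sum>k = 0..<n. if j = 0 then g k else if k = j then g k else 0)"
      using that by (intro sum.cong) (auto simp: P_def)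
    then show ?thesis
      using that by simp
  qed
  have QP: "Q * P = 1\<^sub>m n"
    using carr by (intro eq_matI) (auto simp: scalar_prod_def sumQ P_def)
  have PQ: "P * Q = 1\<^sub>m n"
  proof (rule eq_matI)
    fix i j assume "i < dim_row (1\<^sub>m n :: 'a mat)" "j < dim_col (1\<^sub>m n :: 'a mat)"
    then have ij: "i < n" "j < n" by auto
    have "(P * Q) $$ (i, j) = (\<Sum>k = 0..<n. P $$ (i, k) * Q $$ (k, j))"
      using ij carr by (intro mult_index) auto
    also have "\<dots> = (\<Sum>k = 0..<n. (if k = i then Q $$ (k, j) else 0) +
        (if k = 0 then if i \<noteq> 0 then Q $$ (k, j) else 0 else 0))"
      using ij by (intro sum.cong) (auto simp: P_def)
    also have "\<dots> = Q $$ (i, j) + (if i \<noteq> 0 then Q $$ (0, j) else 0)"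
      using ij assms by (simp add: sum.distrib)
    also have "\<dots> = 1\<^sub>m n $$ (i, j)"
      using ij by (auto simp: Q_def)
    finally show "(P * Q) $$ (i, j) = 1\<^sub>m n $$ (i, j)" .
  qed (use carr in auto)
  have rowsum: "(\<Sum>k = 0..<n. A $$ (i, k)) = a - b + of_nat n * b" if "i < n" for i
  proof -
    have "(\<Sum>k = 0..<n. A $$ (i, k)) = (\<Sum>k = 0..<n. (if i = k then a - b else 0) + b)"
      using that by (intro sum.cong) (auto simp: A_def)
    then show ?thesis using that by (simp add: sum.distrib)
  qed
  have AP: "(A * P) $$ (i, j) = (if j = 0 then a - b + of_nat n * b else A $$ (i, j))"
    if "i < n" "j < n" for i j
  proof -
    have "(A * P) $$ (i, j) = (\<Sum>k = 0..<n. A $$ (i, k) * P $$ (k, j))"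
      using that carr by (intro mult_index) auto
    then show ?thesis using that by (simp add: sumP rowsum)
  qed
  have "T = Q * (A * P)"
  proof (rule eq_matI)
    fix i j assume "i < dim_row (Q * (A * P))" "j < dim_col (Q * (A * P))"
    then have ij: "i < n" "j < n" using carr by auto
    have "(Q * (A * P)) $$ (i, j) = (\<Sum>k = 0..<n. Q $$ (i, k) * (A * P) $$ (k, j))"
      using ij carr by (intro mult_index) auto
    also have "\<dots> = (if i = 0 then (A * P) $$ (0, j) else (A * P) $$ (i, j) - (A * P) $$ (0, j))"
      by (rule sumQ[OF ij(1)])
    also have "\<dots> = T $$ (i, j)"
      using ij by (simp add: AP) (auto simp: T_def A_def)
    finally show "T $$ (i, j) = (Q * (A * P)) $$ (i, j)" ..
  qed (use carr in auto)
  then have "T = Q * A * P"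
    using carr by (simp add: assoc_mult_mat)
  then have "similar_mat T A"
    using carr PQ QP by (intro similar_matI[of _ _ Q P n]) auto
  then have "char_poly A = char_poly T"
    by (metis char_poly_similar)
  also have "\<dots> = (\<Prod>x\<leftarrow>diag_mat T. [:- x, 1:])"
    using carr by (intro char_poly_upper_triangular[of T n]) (auto simp: T_def)
  also have "diag_mat T = (a - b + of_nat n * b) # replicate (n - 1) (a - b)"
    using carr assms
    by (intro nth_equalityI) (auto simp: diag_mat_def T_def nth_Cons split: nat.splits)
  also have "(\<Prod>x\<leftarrow>\<dots>. [:- x, 1:]) = [:- (a - b + of_nat n * b), 1:] * [:- (a - b), 1:] ^ (n - 1)"
    by simp
  finally show ?thesis by (simp add: A_def)
qed

text \<open>Listing \<open>xs\<close> before \<open>ys\<close> makes the characteristic matrix block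
  upper triangular, so its determinant is the product of those of the diagonal blocks.\<close>

lemma char_poly_append:
  fixes f :: "'v \<Rightarrow> 'v \<Rightarrow> 'a :: idom"
  assumes "\<And>x y. x \<in> set xs \<Longrightarrow> y \<in> set ys \<Longrightarrow> f y x = 0"
  defines "M \<equiv> \<lambda>vs. mat (length vs) (length vs) (\<lambda>(i, j). f (vs ! i) (vs ! j))"
  shows "char_poly (M (xs @ ys)) = char_poly (M xs) * char_poly (M ys)"
proof -
  let ?n = "length xs" and ?m = "length ys"
  define B where "B = mat ?n ?m (\<lambda>(i, j). [:- f (xs ! i) (ys ! j):])"
  have "char_poly_matrix (M (xs @ ys)) =
      four_block_mat (char_poly_matrix (M xs)) B (0\<^sub>m ?m ?n) (char_poly_matrix (M ys))"
    using assms(1)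
    by (intro eq_matI) (auto simp: char_poly_matrix_def M_def B_def nth_append)
  then show ?thesis
    unfolding char_poly_def
    by (subst det_four_block_mat_lower_left_zero[symmetric, of _ ?n B ?m])
       (auto simp: M_def B_def)
qed

text \<open>Induction on the set of classes, with one new diagonal block per step. The enumeration
  is existential because it has to list the vertices class by class; \<open>L_spec_eq\<close> and
  \<open>Q_spec_eq\<close> later remove the dependence on it.\<close>

lemma eigenvalue_mset_block_diagonal:
  fixes f :: "'v \<Rightarrow> 'v \<Rightarrow> complex" and C :: "'r \<Rightarrow> 'v set" and a b :: "'r \<Rightarrow> complex"
  assumes "finite R" "disjoint_family_on C R"
    and "\<And>r. r \<in> R \<Longrightarrow> finite (C r) \<and> C r \<noteq> {}"
    and "\<And>r x y. r \<in> R \<Longrightarrow> x \<in> C r \<Longrightarrow> y \<in> C r \<Longrightarrow> f x y = (if x = y then a r else b r)"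
    and "\<And>r s x y. r \<in> R \<Longrightarrow> s \<in> R \<Longrightarrow> r \<noteq> s \<Longrightarrow> x \<in> C r \<Longrightarrow> y \<in> C s \<Longrightarrow> f x y = 0"
  defines "M \<equiv> \<lambda>vs. mat (length vs) (length vs) (\<lambda>(i, j). f (vs ! i) (vs ! j))"
  shows "\<exists>vs. distinct vs \<and> set vs = (\<Union>r\<in>R. C r) \<and> eigenvalue_mset (M vs) =
     (\<Sum>r\<in>R. add_mset (a r - b r + of_nat (card (C r)) * b r)
               (replicate_mset (card (C r) - 1) (a r - b r)))"
  using assms(1-5)
proof (induction R rule: finite_induct)
  case empty
  show ?case by (simp add: M_def eigenvalue_mset_def char_poly_def)
next
  case (insert r R)
  have "disjoint_family_on C R"
    using insert.prems(1) by (rule disjoint_family_on_mono[rotated]) auto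
  then have "\<exists>vs. distinct vs \<and> set vs = (\<Union>r\<in>R. C r) \<and> eigenvalue_mset (M vs) =
     (\<Sum>r\<in>R. add_mset (a r - b r + of_nat (card (C r)) * b r)
               (replicate_mset (card (C r) - 1) (a r - b r)))"
    by (rule insert.IH) (rule insert.prems(2-4); simp)+
  then obtain ys where ys: "distinct ys" "set ys = (\<Union>r\<in>R. C r)" "eigenvalue_mset (M ys) =
     (\<Sum>r\<in>R. add_mset (a r - b r + of_nat (card (C r)) * b r)
               (replicate_mset (card (C r) - 1) (a r - b r)))"
    by (elim exE conjE)
  obtain xs where xs: "distinct xs" "set xs = C r"
    using insert.prems(2)[of r] finite_distinct_list by auto
  have len: "length xs = card (C r)" "length xs > 0"
    using xs insert.prems(2)[of r] distinct_card[of xs] by auto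
  \<comment> \<open>\<open>proots\<close> turns products into sums only for nonzero polynomials;
    characteristic polynomials are monic.\<close>
  have nz: "char_poly (M vs) \<noteq> 0" for vs
    using degree_monic_char_poly[of "M vs" "length vs"] by (auto simp: M_def)
  have "M xs = mat (length xs) (length xs) (\<lambda>(i, j). if i = j then a r else b r)"
    using xs insert.prems(3)[of r] nth_mem[of _ xs]
    by (intro eq_matI) (auto simp: M_def nth_eq_iff_index_eq)
  then have "char_poly (M xs) = [:- (a r - b r + of_nat (card (C r)) * b r), 1:] *
      [:- (a r - b r), 1:] ^ (card (C r) - 1)"
    using char_poly_clique[OF len(2), of "a r" "b r"] len by simp
  then have "eigenvalue_mset (M xs) = add_mset (a r - b r + of_nat (card (C r)) * b r)
      (replicate_mset (card (C r) - 1) (a r - b r))"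
    using nz[of xs]
    by (simp add: eigenvalue_mset_def proots_mult proots_power del: mult_pCons_left)
  moreover have "char_poly (M (xs @ ys)) = char_poly (M xs) * char_poly (M ys)"
    unfolding M_def
    by (rule char_poly_append) (use xs ys insert.prems(4) insert.hyps in blast)
  ultimately have "eigenvalue_mset (M (xs @ ys)) =
     (\<Sum>r\<in>insert r R. add_mset (a r - b r + of_nat (card (C r)) * b r)
               (replicate_mset (card (C r) - 1) (a r - b r)))"
    using nz insert.hyps ys(3) by (simp add: eigenvalue_mset_def proots_mult)
  moreover have "distinct (xs @ ys)"
    using xs ys insert.prems(1) insert.hyps
    by (auto simp: disjoint_family_on_def)
  ultimately show ?case
    using xs ys by (intro exI[of _ "xs @ ys"]) auto
qed

lemma cliques_spec:
  fixes \<G> :: "'v pair_pre_digraph" and C :: "'r \<Rightarrow> 'v set"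
  assumes "finite R" "disjoint_family_on C R"
    and "\<And>r. r \<in> R \<Longrightarrow> finite (C r) \<and> C r \<noteq> {}"
    and "pverts \<G> = (\<Union>r\<in>R. C r)"
    and "parcs \<G> = {(x, y). x \<noteq> y \<and> (\<exists>r\<in>R. x \<in> C r \<and> y \<in> C r)}"
  shows "L_spec \<G> = (\<Sum>r\<in>R. add_mset 0 (replicate_mset (card (C r) - 1) (of_nat (card (C r)))))"
    and "Q_spec \<G> = (\<Sum>r\<in>R. add_mset (2 * of_nat (card (C r)) - 2)
                                (replicate_mset (card (C r) - 1) (of_nat (card (C r)) - 2)))"
proof -
  have uniq: "r = s" if "r \<in> R" "s \<in> R" "x \<in> C r" "x \<in> C s" for r s x
    using that assms(2) by (auto simp: disjoint_family_on_def)
  have deg: "of_nat (out_degree (with_proj \<G>) x) = (of_nat (card (C r)) - 1 :: complex)"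
    if "r \<in> R" "x \<in> C r" for r x
  proof -
    have "e \<in> out_arcs (with_proj \<G>) x \<longleftrightarrow> e \<in> Pair x ` (C r - {x})" for e
    proof (cases e)
      case (Pair u v)
      have "(x, v) \<in> parcs \<G> \<longleftrightarrow> v \<in> C r - {x}"
        using that uniq unfolding assms(5) by blast
      then show ?thesis by (auto simp: Pair out_arcs_def)
    qed
    then have "out_arcs (with_proj \<G>) x = Pair x ` (C r - {x})" by blast
    then have "out_degree (with_proj \<G>) x = card (C r) - 1"
      using that by (simp add: out_degree_def card_image inj_on_def)
    moreover have "card (C r) > 0" using that assms(3) card_gt_0_iff by blast
    ultimately show ?thesis by (simp add: of_nat_diff)
  qed
  \<comment> \<open>Both matrices at once: \<open>c = - 1\<close> gives the Laplacian and
    \<open>c = 1\<close> the signless Laplacian. A clique of size n contributes the block with n - 1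
    on the diagonal and \<open>c\<close> elsewhere.\<close>
  let ?w = "\<lambda>c x y. (if x = y then of_nat (out_degree (with_proj \<G>) x) else 0)
              + c * (if (x, y) \<in> parcs \<G> then 1 else 0 :: complex)"
  have spec: "\<exists>vs. distinct vs \<and> set vs = (\<Union>r\<in>R. C r) \<and>
      eigenvalue_mset (mat (length vs) (length vs) (\<lambda>(i, j). ?w c (vs ! i) (vs ! j))) =
       (\<Sum>r\<in>R. add_mset (of_nat (card (C r)) - 1 - c + of_nat (card (C r)) * c)
               (replicate_mset (card (C r) - 1) (of_nat (card (C r)) - 1 - c)))" for c
  proof (rule eigenvalue_mset_block_diagonal[OF assms(1-3)])
    fix r x y assume "r \<in> R" "x \<in> C r" "y \<in> C r"
    then show "?w c x y = (if x = y then of_nat (card (C r)) - 1 else c)"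
      by (auto simp: assms(5) deg)
  next
    fix r s x y assume "r \<in> R" "s \<in> R" "r \<noteq> s" "x \<in> C r" "y \<in> C s"
    then have "x \<noteq> y" "(x, y) \<notin> parcs \<G>"
      using uniq unfolding assms(5) by blast+
    then show "?w c x y = 0" by simp
  qed
  obtain vs where "distinct vs" "set vs = (\<Union>r\<in>R. C r)"
    "eigenvalue_mset (laplacian_matrix \<G> vs) =
       (\<Sum>r\<in>R. add_mset 0 (replicate_mset (card (C r) - 1) (of_nat (card (C r)))))"
    using spec[of "- 1"] by (auto simp: laplacian_matrix_conv)
  then show "L_spec \<G> = (\<Sum>r\<in>R. add_mset 0 (replicate_mset (card (C r) - 1) (of_nat (card (C r)))))"
    by (simp add: L_spec_eq assms(4))
  obtain vs where "distinct vs" "set vs = (\<Union>r\<in>R. C r)"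
    "eigenvalue_mset (signless_laplacian_matrix \<G> vs) =
       (\<Sum>r\<in>R. add_mset (2 * of_nat (card (C r)) - 2)
               (replicate_mset (card (C r) - 1) (of_nat (card (C r)) - 2)))"
    using spec[of 1] by (auto simp: signless_laplacian_matrix_conv algebra_simps)
  then show "Q_spec \<G> = (\<Sum>r\<in>R. add_mset (2 * of_nat (card (C r)) - 2)
                                (replicate_mset (card (C r) - 1) (of_nat (card (C r)) - 2)))"
    by (simp add: Q_spec_eq assms(4))
qed

lemma sum_constant_mset: "(\<Sum>x\<in>A. M) = repeat_mset (card A) M"
  by (induction A rule: infinite_finite_induct) auto

section \<open>Commuting graphs and $2\times2$ matrices\<close>

text \<open>Cosets of the trivial subgroup are singletons, so passing to the quotient merely wraps
  each element in a set.\<close>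

lemma (in group) commuting_graph_Mod_trivial_center:
  assumes "center G = {\<one>}"
  shows "pverts (commuting_graph (G Mod center G)) = (\<lambda>x. {x}) ` (carrier G - {\<one>})"
    and "parcs (commuting_graph (G Mod center G)) =
      {({x}, {y}) |x y. x \<in> carrier G - {\<one>} \<and> y \<in> carrier G - {\<one>} \<and>
                       x \<noteq> y \<and> x \<otimes> y = y \<otimes> x}"
proof -
  have carr: "carrier (G Mod center G) = (\<lambda>x. {x}) ` carrier G"
    unfolding carrier_FactGroup assms by (intro image_cong) (simp_all add: r_coset_def)
  have mult: "{x} <#> {y} = {x \<otimes> y}" for x y
    by (simp add: set_mult_def)
  have "center (G Mod center G) = (\<lambda>x. {x}) ` center G"
    unfolding center_def[of "G Mod center G"] carr by (auto simp: mult) (auto simp: center_def)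
  then have cen: "center (G Mod center G) = {{\<one>}}"
    by (simp add: assms)
  show "pverts (commuting_graph (G Mod center G)) = (\<lambda>x. {x}) ` (carrier G - {\<one>})"
    unfolding commuting_graph_def by (auto simp: carr cen)
  show "parcs (commuting_graph (G Mod center G)) =
      {({x}, {y}) |x y. x \<in> carrier G - {\<one>} \<and> y \<in> carrier G - {\<one>} \<and>
                       x \<noteq> y \<and> x \<otimes> y = y \<otimes> x}"
    unfolding commuting_graph_def carr cen by (auto simp: mult)
qed

definition mat2 :: "'a \<Rightarrow> 'a \<Rightarrow> 'a \<Rightarrow> 'a \<Rightarrow> 'a mat" where
  "mat2 a b c d =
     mat 2 2 (\<lambda>(i, j). if i = 0 then if j = 0 then a else b else if j = 0 then c else d)"

lemma mat2_carrier [simp]: "mat2 a b c d \<in> carrier_mat 2 2"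
  by (simp add: mat2_def)

lemma mat2_eq_iff [simp]:
  "mat2 a b c d = mat2 a' b' c' d' \<longleftrightarrow> a = a' \<and> b = b' \<and> c = c' \<and> d = d'"
proof
  assume eq: "mat2 a b c d = mat2 a' b' c' d'"
  have "mat2 a b c d $$ (i, j) = mat2 a' b' c' d' $$ (i, j)" for i j by (simp add: eq)
  from this[of 0 0] this[of 0 1] this[of 1 0] this[of 1 1]
  show "a = a' \<and> b = b' \<and> c = c' \<and> d = d'" by (simp add: mat2_def)
qed simp

lemma mat2_exhaust:
  assumes "A \<in> carrier_mat 2 2"
  obtains a b c d where "A = mat2 a b c d"
proof
  show "A = mat2 (A $$ (0, 0)) (A $$ (0, 1)) (A $$ (1, 0)) (A $$ (1, 1))"
    using assms by (intro eq_matI) (auto simp: mat2_def less_2_cases_iff)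
qed

lemma mat2_mult:
  fixes a :: "'a :: comm_ring_1"
  shows "mat2 a b c d * mat2 a' b' c' d' =
    mat2 (a * a' + b * c') (a * b' + b * d') (c * a' + d * c') (c * b' + d * d')"
  by (intro eq_matI) (auto simp: mat2_def scalar_prod_def less_2_cases_iff numeral_2_eq_2)

lemma det_mat2: "det (mat2 a b c d) = a * d - b * (c :: 'a :: comm_ring_1)"
proof -
  have "det (mat2 a b c d) =
      (\<Sum>i<2. mat2 a b c d $$ (i, 0) * cofactor (mat2 a b c d) i 0)"
    by (rule laplace_expansion_column) auto
  then show ?thesis
    by (simp add: numeral_2_eq_2 cofactor_def mat_delete_def mat2_def det_single)
qed

lemma one_mat2: "1\<^sub>m 2 = mat2 1 0 0 (1 :: 'a :: comm_ring_1)"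
  by (intro eq_matI) (auto simp: mat2_def less_2_cases_iff)

section \<open>Centralizers in $SL(2,q)$ for even $q$\<close>

locale finite_field_char2 =
  fixes q :: nat and ty :: "'a :: field itself"
  assumes finite_field: "finite (UNIV :: 'a set)"
    and two_eq_0: "(2 :: 'a) = 0"
    and card_field: "q = card (UNIV :: 'a set)"
begin

section \<open>Arithmetic and square roots in characteristic 2\<close>

lemma add_self: "x + x = (0 :: 'a)"
  by (simp only: mult_2[symmetric] two_eq_0 mult_zero_left)

lemma add_left_self: "x + (x + y) = (y :: 'a)"
  by (simp add: add.assoc[symmetric] add_self)

lemma diff_eq_add: "x - y = x + (y :: 'a)"
  by (simp add: diff_eq_eq add.assoc add_self)

lemma add_eq_0_iff_eq: "x + y = 0 \<longleftrightarrow> x = (y :: 'a)"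
  by (simp flip: diff_eq_add)

lemma power2_eq_iff': "x\<^sup>2 = y\<^sup>2 \<longleftrightarrow> x = (y :: 'a)"
proof -
  have "x\<^sup>2 + y\<^sup>2 = (x + y)\<^sup>2"
    by (simp add: power2_sum two_eq_0)
  then show ?thesis
    by (metis add_eq_0_iff_eq zero_eq_power2)
qed

text \<open>Squaring is injective, hence surjective on a finite field, so the inverse of
  \<open>e\<close> has exactly one square root.\<close>

lemma ex_scale:
  assumes "e \<noteq> (0 :: 'a)"
  shows "\<exists>!s. s\<^sup>2 * e = 1"
proof -
  have "inj (\<lambda>x :: 'a. x\<^sup>2)" by (simp add: inj_def power2_eq_iff')
  then have "surj (\<lambda>x :: 'a. x\<^sup>2)" using finite_field by (metis finite_UNIV_inj_surj)
  then obtain s where "inverse e = s\<^sup>2" by (rule surjE)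
  then have s: "s\<^sup>2 * e = 1" using assms by (metis left_inverse)
  show ?thesis
  proof (rule ex1I)
    fix t assume "t\<^sup>2 * e = 1"
    then have "t\<^sup>2 = s\<^sup>2" using s assms by (metis mult_right_cancel)
    then show "t = s" by (simp add: power2_eq_iff')
  qed (rule s)
qed

text \<open>The inverse square root: multiplying a 2x2 matrix of determinant \<open>e\<close> by
  \<open>scale e\<close> makes its determinant 1.\<close>

definition scale :: "'a \<Rightarrow> 'a" where
  "scale e = (THE s. s\<^sup>2 * e = 1)"

lemma scale: "e \<noteq> 0 \<Longrightarrow> (scale e)\<^sup>2 * e = 1"
  unfolding scale_def by (rule theI') (rule ex_scale)

lemma scale_eqI: "s\<^sup>2 * e = 1 \<Longrightarrow> scale e = s"
  by (metis ex_scale mult_zero_right scale zero_neq_one)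

lemma scale_nonzero: "e \<noteq> 0 \<Longrightarrow> scale e \<noteq> 0"
  using scale by fastforce

text \<open>The commuting class of a non-scalar matrix is determined by the line spanned by its two
  off-diagonal entries and its trace. The set below contains one normalised vector from each of
  the $q^2+q+1$ lines.\<close>

definition directions :: "('a \<times> 'a \<times> 'a) set" where
  "directions = {(x, y, z). z = 1 \<or> z = 0 \<and> x = 1 \<or> z = 0 \<and> x = 0 \<and> y = 1}"

text \<open>The polynomial is the characteristic polynomial of \<open>mat2 0 x y z\<close>, as signs
  are immaterial in characteristic 2.\<close>

definition nonroots :: "'a \<times> 'a \<times> 'a \<Rightarrow> 'a set" where
  "nonroots = (\<lambda>(x, y, z). {w. w\<^sup>2 + z * w + x * y \<noteq> 0})"

text \<open>A matrix with off-diagonal entries \<open>x\<close>, \<open>y\<close>, trace \<open>z\<close> and upper left entry \<open>w\<close> has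
  determinant $w^2 + zw + xy$; if this is nonzero, exactly one multiple of the matrix lies in
  $SL(2,q)$.\<close>

definition clique :: "'a \<times> 'a \<times> 'a \<Rightarrow> 'a mat set" where
  "clique = (\<lambda>(x, y, z). (\<lambda>w. let s = scale (w\<^sup>2 + z * w + x * y)
     in mat2 (s * w) (s * x) (s * y) (s * (w + z))) ` nonroots (x, y, z))"

text \<open>Removes the parameter \<open>w\<close> and the chosen scale: the entries only have to be
  proportional to \<open>(x, y, z)\<close>, since the determinant condition forces the factor
  \<open>u\<close> to be the value of \<open>scale\<close>.\<close>

lemma mem_clique_iff:
  "mat2 a b c d \<in> clique (x, y, z) \<longleftrightarrow>
     a * d + b * c = 1 \<and> (\<exists>u. u \<noteq> 0 \<and> b = u * x \<and> c = u * y \<and> a + d = u * z)"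
proof
  assume "mat2 a b c d \<in> clique (x, y, z)"
  then obtain w where w: "w\<^sup>2 + z * w + x * y \<noteq> 0"
    and eq: "mat2 a b c d = (let s = scale (w\<^sup>2 + z * w + x * y)
     in mat2 (s * w) (s * x) (s * y) (s * (w + z)))"
    unfolding clique_def nonroots_def by auto
  define s where "s = scale (w\<^sup>2 + z * w + x * y)"
  have s: "s\<^sup>2 * (w\<^sup>2 + z * w + x * y) = 1" "s \<noteq> 0"
    using scale[OF w] scale_nonzero[OF w] by (auto simp: s_def)
  have abcd: "a = s * w" "b = s * x" "c = s * y" "d = s * (w + z)"
    using eq by (auto simp: s_def[symmetric] Let_def)
  have "a * d + b * c = s\<^sup>2 * (w\<^sup>2 + z * w + x * y)"
    unfolding abcd by (simp add: algebra_simps power2_eq_square)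
  moreover have "a + d = s * z"
    unfolding abcd by (simp add: distrib_left add_left_self)
  ultimately show "a * d + b * c = 1 \<and> (\<exists>u. u \<noteq> 0 \<and> b = u * x \<and> c = u * y \<and> a + d = u * z)"
    using s abcd by auto
next
  assume "a * d + b * c = 1 \<and> (\<exists>u. u \<noteq> 0 \<and> b = u * x \<and> c = u * y \<and> a + d = u * z)"
  then obtain u where det: "a * d + b * c = 1"
    and u: "u \<noteq> 0" "b = u * x" "c = u * y" "a + d = u * z" by blast
  define w where "w = a / u"
  have a: "a = u * w" using u by (simp add: w_def)
  have d: "d = u * (w + z)" unfolding distrib_left u(4)[symmetric] a by (simp add: add_left_self)
  have 1: "u\<^sup>2 * (w\<^sup>2 + z * w + x * y) = 1"
    using det unfolding a d u(2,3) by (simp add: algebra_simps power2_eq_square)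
  then have "w \<in> nonroots (x, y, z)" unfolding nonroots_def by auto
  moreover have "mat2 a b c d = (let s = scale (w\<^sup>2 + z * w + x * y)
     in mat2 (s * w) (s * x) (s * y) (s * (w + z)))"
    unfolding scale_eqI[OF 1] by (simp add: a d u)
  ultimately show "mat2 a b c d \<in> clique (x, y, z)"
    unfolding clique_def by blast
qed

lemma clique_subset: "clique t \<subseteq> carrier_mat 2 2"
  by (cases t) (auto simp: clique_def Let_def)

text \<open>A common matrix would make the two triples proportional, and \<open>directions\<close>
  meets each line only once.\<close>

lemma clique_disjoint: "disjoint_family_on clique directions"
proof -
  have "t = t'"
    if t: "t \<in> directions" "t' \<in> directions" and A: "A \<in> clique t" "A \<in> clique t'" for t t' A
  proof -
    obtain x y z x' y' z' where tt: "t = (x, y, z)" "t' = (x', y', z')" by (metis prod_cases3)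
    obtain a b c d where "A = mat2 a b c d"
      using A clique_subset mat2_exhaust by blast
    then obtain u u' where "u \<noteq> 0" "u' \<noteq> 0" "u * x = u' * x'" "u * y = u' * y'" "u * z = u' * z'"
      using A unfolding tt by (auto simp: mem_clique_iff)
    then show ?thesis using t unfolding tt directions_def by auto
  qed
  then show ?thesis unfolding disjoint_family_on_def by blast
qed

text \<open>The off-diagonal entries and the trace all vanish only for scalar matrices, and the only
  scalar matrix of determinant 1 is the identity because \<open>a\<^sup>2 = 1\<close> forces
  \<open>a = 1\<close>.\<close>

lemma Union_clique: "(\<Union>t\<in>directions. clique t) = {A \<in> carrier_mat 2 2. det A = 1} - {1\<^sub>m 2}"
proof -
  have "mat2 a b c d \<in> (\<Union>t\<in>directions. clique t) \<longleftrightarrow> a * d + b * c = 1 \<and> mat2 a b c d \<noteq> 1\<^sub>m 2"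
    for a b c d
  proof
    assume "mat2 a b c d \<in> (\<Union>t\<in>directions. clique t)"
    then obtain x y z where t: "(x, y, z) \<in> directions" "mat2 a b c d \<in> clique (x, y, z)" by auto
    then show "a * d + b * c = 1 \<and> mat2 a b c d \<noteq> 1\<^sub>m 2"
      by (auto simp: mem_clique_iff one_mat2 directions_def add_self)
  next
    assume A: "a * d + b * c = 1 \<and> mat2 a b c d \<noteq> 1\<^sub>m 2"
    have "b \<noteq> 0 \<or> c \<noteq> 0 \<or> a + d \<noteq> 0"
    proof (rule ccontr)
      assume "\<not> ?thesis"
      then have "b = 0" "c = 0" "a = d" by (auto simp: add_eq_0_iff_eq)
      moreover from this have "a\<^sup>2 = 1\<^sup>2" using A by (simp add: power2_eq_square)
      then have "a = 1" by (simp only: power2_eq_iff')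
      ultimately show False using A by (simp add: one_mat2)
    qed
    \<comment> \<open>The cases follow the three normal forms in \<open>directions\<close>; in each,
      the coordinate known to be nonzero is divided out and serves as \<open>u\<close>.\<close>
    then consider "a + d \<noteq> 0" | "a + d = 0" "b \<noteq> 0" | "a + d = 0" "b = 0" "c \<noteq> 0" by blast
    then show "mat2 a b c d \<in> (\<Union>t\<in>directions. clique t)"
    proof cases
      case 1
      then have "mat2 a b c d \<in> clique (b / (a + d), c / (a + d), 1)"
        using A by (auto simp: mem_clique_iff intro!: exI[of _ "a + d"])
      then show ?thesis by (auto simp: directions_def)
    next
      case 2
      then have "mat2 a b c d \<in> clique (1, c / b, 0)"
        using A by (auto simp: mem_clique_iff intro!: exI[of _ b])
      then show ?thesis by (auto simp: directions_def)
    next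
      case 3
      then have "mat2 a b c d \<in> clique (0, 1, 0)"
        using A by (auto simp: mem_clique_iff intro!: exI[of _ c])
      then show ?thesis by (auto simp: directions_def)
    qed
  qed
  then have "A \<in> (\<Union>t\<in>directions. clique t) \<longleftrightarrow> det A = 1 \<and> A \<noteq> 1\<^sub>m 2"
    if "A \<in> carrier_mat 2 2" for A
    using mat2_exhaust[OF that] by (metis det_mat2 diff_eq_add)
  moreover have "(\<Union>t\<in>directions. clique t) \<subseteq> carrier_mat 2 2"
    using clique_subset by blast
  ultimately show ?thesis by blast
qed

text \<open>Comparing the entries of both products leaves the vanishing of the 2x2 minors of
  \<open>(b, c, a + d)\<close> and \<open>(b', c', a' + d')\<close>, that is, their
  proportionality.\<close>

lemma clique_commute_iff:
  assumes "t \<in> directions" "A \<in> clique t"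
    and "t' \<in> directions" "B \<in> clique t'"
  shows "A * B = B * A \<longleftrightarrow> t = t'"
proof -
  obtain x y z x' y' z' where tt: "t = (x, y, z)" "t' = (x', y', z')" by (metis prod_cases3)
  obtain a b c d a' b' c' d' where AB: "A = mat2 a b c d" "B = mat2 a' b' c' d'"
    using assms clique_subset by (meson mat2_exhaust subsetD)
  obtain u u' where u: "u \<noteq> 0" "u' \<noteq> 0"
    and A: "b = u * x" "c = u * y" "a + d = u * z"
    and B: "b' = u' * x'" "c' = u' * y'" "a' + d' = u' * z'"
    using assms unfolding AB tt by (auto simp: mem_clique_iff)
  have "A * B = B * A \<longleftrightarrow>
      b * c' = b' * c \<and> b' * (a + d) = b * (a' + d') \<and> c' * (a + d) = c * (a' + d')"
  proof -
    \<comment> \<open>In characteristic 2 an equation holds iff the sum of its two sides is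
      0.\<close>
    have eq_cong: "e = f \<longleftrightarrow> g = h" if "e + f = g + h" for e f g h :: 'a
      using that by (metis add_eq_0_iff_eq)
    have "a * a' + b * c' = a' * a + b' * c \<longleftrightarrow> b * c' = b' * c"
      "c * b' + d * d' = c' * b + d' * d \<longleftrightarrow> b * c' = b' * c"
      by (auto simp: mult.commute)
    moreover have "a * b' + b * d' = a' * b + b' * d \<longleftrightarrow> b' * (a + d) = b * (a' + d')"
      "c * a' + d * c' = c' * a + d' * c \<longleftrightarrow> c' * (a + d) = c * (a' + d')"
      by (rule eq_cong, simp add: distrib_left ac_simps)+
    ultimately show ?thesis
      unfolding AB mat2_mult mat2_eq_iff by blast
  qed
  also have "\<dots> \<longleftrightarrow> x * y' = x' * y \<and> x' * z = x * z' \<and> y' * z = y * z'"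
    unfolding A B using u by auto
  also have "\<dots> \<longleftrightarrow> t = t'"
    using assms(1,3) unfolding tt directions_def by auto
  finally show ?thesis .
qed

section \<open>Sizes and numbers of the cliques\<close>

text \<open>The parametrisation by \<open>w\<close> is injective: some coordinate of
  \<open>t\<close> is 1, so the off-diagonal entries or the trace reveal the factor
  \<open>s\<close>, and then the upper left entry reveals \<open>w\<close>.\<close>

lemma card_clique:
  assumes "t \<in> directions"
  shows "card (clique t) = card (nonroots t)"
proof -
  obtain x y z where t: "t = (x, y, z)" by (metis prod_cases3)
  have "inj_on (\<lambda>w. let s = scale (w\<^sup>2 + z * w + x * y)
     in mat2 (s * w) (s * x) (s * y) (s * (w + z))) (nonroots t)"
  proof (rule inj_onI)
    fix v w assume "v \<in> nonroots t" "w \<in> nonroots t"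
    then have nz: "scale (v\<^sup>2 + z * v + x * y) \<noteq> 0" "scale (w\<^sup>2 + z * w + x * y) \<noteq> 0"
      by (auto simp: t nonroots_def scale_nonzero)
    assume eq: "(let s = scale (v\<^sup>2 + z * v + x * y) in mat2 (s * v) (s * x) (s * y) (s * (v + z)))
      = (let s = scale (w\<^sup>2 + z * w + x * y) in mat2 (s * w) (s * x) (s * y) (s * (w + z)))"
    then have "scale (v\<^sup>2 + z * v + x * y) = scale (w\<^sup>2 + z * w + x * y)"
      using assms by (auto simp: t directions_def Let_def algebra_simps)
    then show "v = w" using eq nz by (auto simp: Let_def)
  qed
  then show ?thesis by (simp add: t clique_def card_image)
qed

text \<open>These are the pairs for which the characteristic polynomial with trace 1 splits. Their
  cliques are the split tori without the identity, while the other pairs give the nonsplit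
  tori.\<close>

definition split_pairs :: "('a \<times> 'a) set" where
  "split_pairs = {(x, y). \<exists>w. w\<^sup>2 + w = x * y}"

lemma q_ge_2: "q \<ge> 2"
proof -
  have "card {0, 1 :: 'a} \<le> q" unfolding card_field by (rule card_mono) (use finite_field in auto)
  then show ?thesis by simp
qed

lemma card_nonroots:
  assumes "finite S" "S = {w. w\<^sup>2 + z * w + x * y = 0}"
  shows "card (nonroots (x, y, z)) = q - card S"
proof -
  have "nonroots (x, y, z) = UNIV - S" using assms by (auto simp: nonroots_def)
  then show ?thesis using finite_field by (simp add: card_field card_Diff_subset finite_subset[of S UNIV])
qed

text \<open>In characteristic 2 the sum of \<open>v\<^sup>2 + v\<close> and
  \<open>w\<^sup>2 + w\<close> factors as \<open>(v + w) * (v + (w + 1))\<close>.\<close>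

lemma Artin_Schreier_roots:
  assumes "w\<^sup>2 + w = (e :: 'a)"
  shows "{v. v\<^sup>2 + v = e} = {w, w + 1}"
proof -
  have "v\<^sup>2 + v = e \<longleftrightarrow> v = w \<or> v = w + 1" for v
  proof -
    have "(v + w) * (v + (w + 1)) = (v\<^sup>2 + v) + (w\<^sup>2 + w) + (v * w + v * w)"
      by (simp add: algebra_simps power2_eq_square)
    then have "v\<^sup>2 + v = e \<longleftrightarrow> (v + w) * (v + (w + 1)) = 0"
      by (simp only: add_self assms add_eq_0_iff_eq add_0_right)
    then show ?thesis by (simp add: add_eq_0_iff_eq)
  qed
  then show ?thesis by blast
qed

text \<open>With trace 0 the polynomial is the square of a linear one, so it has a single
  root.\<close>

lemma card_nonroots_unipotent:
  "card (nonroots (x, y, 0)) = q - 1"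
proof -
  have "surj (\<lambda>x :: 'a. x\<^sup>2)"
    using finite_field by (intro finite_UNIV_inj_surj) (auto simp: inj_def power2_eq_iff')
  then obtain r where r: "x * y = r\<^sup>2" by (rule surjE)
  have "{w. w\<^sup>2 + 0 * w + x * y = 0} = {r}"
    by (auto simp: r add_eq_0_iff_eq power2_eq_iff')
  then show ?thesis by (subst card_nonroots[of "{r}"]) auto
qed

lemma card_nonroots_torus:
  "card (nonroots (x, y, 1)) = (if (x, y) \<in> split_pairs then q - 2 else q)"
proof -
  have eq: "{w. w\<^sup>2 + 1 * w + x * y = 0} = {w. w\<^sup>2 + w = x * y}"
    by (simp add: add_eq_0_iff_eq)
  show ?thesis
  proof (cases "(x, y) \<in> split_pairs")
    case True
    then obtain w where "w\<^sup>2 + w = x * y" by (auto simp: split_pairs_def)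
    from Artin_Schreier_roots[OF this] show ?thesis
      using True by (subst card_nonroots[OF _ eq[symmetric]]) auto
  next
    case False
    then have "{w. w\<^sup>2 + w = x * y} = {}" by (auto simp: split_pairs_def)
    then show ?thesis
      using False by (subst card_nonroots[OF _ eq[symmetric]]) auto
  qed
qed

text \<open>Double counting of the triples \<open>(x, y, w)\<close> with $w^2 + w = xy$: every split pair has two
  roots \<open>w\<close>, while the number of \<open>y\<close> is determined by \<open>x\<close> and \<open>w\<close>.\<close>

lemma card_split_pairs: "2 * card split_pairs = q * (q + 1)"
proof -
  define T where "T = {((x, y), w :: 'a). w\<^sup>2 + w = x * y}"
  have fin: "finite (A :: 'a set)" for A
    using finite_field by (rule rev_finite_subset) simp
  have "finite (UNIV :: ('a \<times> 'a) set)"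
    using finite_field by (simp add: finite_prod)
  then have fin2: "finite (A :: ('a \<times> 'a) set)" for A
    by (rule rev_finite_subset) simp
  have "T = (SIGMA p:split_pairs. {w. w\<^sup>2 + w = fst p * snd p})"
    by (auto simp: T_def split_pairs_def)
  then have "card T = (\<Sum>p\<in>split_pairs. card {w. w\<^sup>2 + w = fst p * snd p})"
    using fin fin2 by simp
  also have "\<dots> = (\<Sum>p\<in>split_pairs. 2)"
  proof (rule sum.cong)
    fix p assume "p \<in> split_pairs"
    then obtain w where "w\<^sup>2 + w = fst p * snd p" by (auto simp: split_pairs_def)
    from Artin_Schreier_roots[OF this]
    show "card {w. w\<^sup>2 + w = fst p * snd p} = 2" by simp
  qed simp
  finally have T1: "card T = 2 * card split_pairs" by simp
  \<comment> \<open>\<open>?A\<close> collects the triples with nonzero \<open>x\<close>, where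
    \<open>y\<close> is obtained by division; in \<open>?B\<close>, where \<open>x = 0\<close>,
    \<open>y\<close> is free and \<open>w\<close> is 0 or 1.\<close>
  let ?A = "(\<lambda>(x :: 'a, w). ((x, (w\<^sup>2 + w) / x), w)) ` ((UNIV - {0}) \<times> UNIV)"
  let ?B = "(\<lambda>(y :: 'a, w). ((0 :: 'a, y), w)) ` (UNIV \<times> {0, 1 :: 'a})"
  have roots0: "w\<^sup>2 + w = 0 \<longleftrightarrow> w \<in> {0, 1}" for w :: 'a
    using Artin_Schreier_roots[of 0 0] by auto
  have "T = ?A \<union> ?B"
  proof (rule Set.set_eqI)
    fix e :: "('a \<times> 'a) \<times> 'a"
    obtain x y w where e: "e = ((x, y), w)" by (metis surj_pair)
    show "e \<in> T \<longleftrightarrow> e \<in> ?A \<union> ?B"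
    proof (cases "x = 0")
      case True
      then have "((x, y), w) \<in> T \<longleftrightarrow> w \<in> {0, 1}" using roots0[of w] by (simp add: T_def)
      then show ?thesis using e True by auto
    next
      case False
      then have "((x, y), w) \<in> T \<longleftrightarrow> y = (w\<^sup>2 + w) / x"
        by (auto simp: T_def eq_divide_eq mult.commute)
      then show ?thesis using e False by auto
    qed
  qed
  moreover have "?A \<inter> ?B = {}" by auto
  ultimately have "card T = card ?A + card ?B"
    by (simp only:) (intro card_Un_disjoint finite_imageI finite_cartesian_product fin)
  also have "card ?A = (q - 1) * q"
    using finite_field
    by (subst card_image)
       (auto simp: inj_on_def card_cartesian_product card_Diff_subset card_field)
  also have "card ?B = 2 * q"
    by (subst card_image) (auto simp: inj_on_def card_cartesian_product card_field)
  finally have "card T = (q - 1) * q + 2 * q" .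
  also have "\<dots> = q * (q + 1)"
    using q_ge_2 by (cases q) (auto simp: algebra_simps)
  finally show ?thesis using T1 by simp
qed

section \<open>The commuting graph of PSL(2,q) and its spectra\<close>

lemma center_special_linear: "center (special_linear TYPE('a) 2) = {1\<^sub>m 2}"
proof -
  have "A = 1\<^sub>m 2" if A: "A \<in> center (special_linear TYPE('a) 2)" for A
  proof -
    have A': "A \<in> carrier_mat 2 2" "det A = 1"
      using A by (auto simp: center_def special_linear_def)
    have comm: "A * B = B * A" if "B \<in> carrier_mat 2 2" "det B = 1" for B
      using A that by (auto simp: center_def special_linear_def)
    obtain a b c d where abcd: "A = mat2 a b c d"
      using A'(1) by (rule mat2_exhaust)
    \<comment> \<open>Commuting with the two elementary unipotent matrices already forces a matrix
      to be scalar.\<close>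
    have "a = d" "b = 0"  "c = 0"
      using comm[of "mat2 1 1 0 1"] comm[of "mat2 1 0 1 1"]
      by (auto simp: abcd mat2_mult det_mat2)
    moreover from this A'(2) have "a\<^sup>2 = 1\<^sup>2" by (simp add: abcd det_mat2 power2_eq_square)
    then have "a = 1" by (simp only: power2_eq_iff')
    ultimately show ?thesis by (simp add: abcd one_mat2)
  qed
  moreover have "1\<^sub>m 2 \<in> center (special_linear TYPE('a) 2)"
    by (auto simp: center_def special_linear_def)
  ultimately show ?thesis by blast
qed

lemma commuting_graph_PSL2:
  shows "pverts (commuting_graph (PSL TYPE('a) 2)) = (\<Union>t\<in>directions. (\<lambda>A. {A}) ` clique t)"
    and "parcs (commuting_graph (PSL TYPE('a) 2)) = {(X, Y). X \<noteq> Y \<and>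
      (\<exists>t\<in>directions. X \<in> (\<lambda>A. {A}) ` clique t \<and> Y \<in> (\<lambda>A. {A}) ` clique t)}"
proof -
  let ?SL = "special_linear TYPE('a) 2"
  interpret SL: group ?SL by (rule group_special_linear)
  have one: "\<one>\<^bsub>?SL\<^esub> = 1\<^sub>m 2" and mult: "(\<otimes>\<^bsub>?SL\<^esub>) = (*)"
    by (simp_all add: special_linear_def)
  have V: "carrier ?SL - {1\<^sub>m 2} = (\<Union>t\<in>directions. clique t)"
    by (simp add: Union_clique special_linear_def)
  note graph = SL.commuting_graph_Mod_trivial_center[unfolded one, OF center_special_linear]
  show "pverts (commuting_graph (PSL TYPE('a) 2)) = (\<Union>t\<in>directions. (\<lambda>A. {A}) ` clique t)"
    unfolding PSL_def graph V by blast
  have "A * B = B * A \<longleftrightarrow> (\<exists>t\<in>directions. A \<in> clique t \<and> B \<in> clique t)"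
    if "A \<in> (\<Union>t\<in>directions. clique t)" "B \<in> (\<Union>t\<in>directions. clique t)" for A B
    using that clique_commute_iff by (metis UN_E)
  then show "parcs (commuting_graph (PSL TYPE('a) 2)) = {(X, Y). X \<noteq> Y \<and>
      (\<exists>t\<in>directions. X \<in> (\<lambda>A. {A}) ` clique t \<and> Y \<in> (\<lambda>A. {A}) ` clique t)}"
    unfolding PSL_def graph V mult by blast
qed

lemma finite_directions: "finite directions"
proof -
  have "finite (UNIV :: ('a \<times> 'a \<times> 'a) set)"
    using finite_field by (simp add: finite_prod)
  then show ?thesis by (rule rev_finite_subset) simp
qed

text \<open>Stated for an arbitrary function \<open>F\<close> of the clique size, so that one count
  serves both spectra.\<close>

lemma sum_cliques:
  fixes F :: "nat \<Rightarrow> 'b multiset"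
  shows "(\<Sum>t\<in>directions. F (card (clique t))) = repeat_mset (q + 1) (F (q - 1)) +
     repeat_mset (q * (q + 1) div 2) (F (q - 2)) + repeat_mset (q * (q - 1) div 2) (F q)"
proof -
  have "finite (UNIV :: ('a \<times> 'a) set)"
    using finite_field by (simp add: finite_prod)
  then have fin: "finite (A :: ('a \<times> 'a) set)" for A
    by (rule rev_finite_subset) simp
  \<comment> \<open>\<open>D0\<close> holds the trace 0 directions and \<open>D1\<close> the trace 1
    directions over a given set of pairs.\<close>
  define D0 where "D0 = insert (0, 1, 0) ((\<lambda>y :: 'a. (1 :: 'a, y, 0 :: 'a)) ` UNIV)"
  define D1 where "D1 = (\<lambda>S. (\<lambda>(x :: 'a, y :: 'a). (x, y, 1 :: 'a)) ` S)"
  have inj: "inj_on (\<lambda>(x, y). (x, y, 1)) S" for S :: "('a \<times> 'a) set"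
    by (auto simp: inj_on_def)
  have card_D1: "card (D1 S) = card S" for S
    unfolding D1_def by (rule card_image) (rule inj)
  have card_D0: "card D0 = q + 1"
    unfolding D0_def using finite_field
    by (subst card_insert_disjoint) (auto simp: card_image inj_on_def card_field)
  have split: "card split_pairs = q * (q + 1) div 2"
    using card_split_pairs by (metis nonzero_mult_div_cancel_left zero_neq_numeral)
  have nonsplit: "card (- split_pairs) = q * (q - 1) div 2"
  proof -
    have "card split_pairs + card (- split_pairs) = q * q"
      using fin
      by (subst card_Un_disjoint[symmetric])
         (auto simp: card_field card_cartesian_product simp flip: UNIV_Times_UNIV)
    then have "2 * card (- split_pairs) = q * (q - 1)"
      using card_split_pairs by (auto simp: algebra_simps diff_mult_distrib2)
    then show ?thesis by simp
  qed
  have dir: "directions = D0 \<union> (D1 split_pairs \<union> D1 (- split_pairs))"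
    by (auto simp: directions_def D0_def D1_def image_iff)
  have "(\<Sum>t\<in>directions. F (card (clique t))) = (\<Sum>t\<in>directions. F (card (nonroots t)))"
    by (rule sum.cong) (auto simp: card_clique)
  also have "\<dots> = (\<Sum>t\<in>D0. F (card (nonroots t))) +
      ((\<Sum>t\<in>D1 split_pairs. F (card (nonroots t))) + (\<Sum>t\<in>D1 (- split_pairs). F (card (nonroots t))))"
  proof -
    have "D0 \<inter> (D1 split_pairs \<union> D1 (- split_pairs)) = {}" "D1 split_pairs \<inter> D1 (- split_pairs) = {}"
      by (auto simp: D0_def D1_def)
    moreover have "finite D0" "finite (D1 S)" for S
      using finite_field fin by (auto simp: D0_def D1_def)
    ultimately show ?thesis
      unfolding dir by (simp add: sum.union_disjoint)
  qed
  also have "(\<Sum>t\<in>D0. F (card (nonroots t))) = (\<Sum>t\<in>D0. F (q - 1))"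
    by (rule sum.cong) (auto simp: D0_def card_nonroots_unipotent)
  also have "(\<Sum>t\<in>D1 split_pairs. F (card (nonroots t))) = (\<Sum>t\<in>D1 split_pairs. F (q - 2))"
    by (rule sum.cong) (auto simp: D1_def card_nonroots_torus)
  also have "(\<Sum>t\<in>D1 (- split_pairs). F (card (nonroots t))) = (\<Sum>t\<in>D1 (- split_pairs). F q)"
    by (rule sum.cong) (auto simp: D1_def card_nonroots_torus)
  finally show ?thesis
    by (simp add: sum_constant_mset card_D0 card_D1 split nonsplit add.assoc)
qed

lemma spec_PSL2:
  assumes "q > 2"
  defines "S \<equiv> \<lambda>F :: nat \<Rightarrow> complex multiset. repeat_mset (q + 1) (F (q - 1)) +
     repeat_mset (q * (q + 1) div 2) (F (q - 2)) + repeat_mset (q * (q - 1) div 2) (F q)"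
  shows "L_spec (commuting_graph (PSL TYPE('a) 2)) =
           S (\<lambda>n. add_mset 0 (replicate_mset (n - 1) (of_nat n)))"
    and "Q_spec (commuting_graph (PSL TYPE('a) 2)) =
           S (\<lambda>n. add_mset (2 * of_nat n - 2) (replicate_mset (n - 1) (of_nat n - 2)))"
proof -
  let ?C = "\<lambda>t. (\<lambda>A. {A}) ` clique t"
  have card_C: "card (?C t) = card (clique t)" for t
    by (simp add: card_image)
  have disj: "disjoint_family_on ?C directions"
    using clique_disjoint unfolding disjoint_family_on_def by blast
  \<comment> \<open>The smallest cliques have \<open>q - 2\<close> elements, so \<open>q > 2\<close>
    makes all of them nonempty.\<close>
  have "card (nonroots t) > 0" if "t \<in> directions" for t
    using assms(1) that
    by (cases t) (auto simp: directions_def card_nonroots_unipotent card_nonroots_torus)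
  then have ne: "finite (?C t) \<and> ?C t \<noteq> {}" if "t \<in> directions" for t
    using that card_clique by (metis card_C card_gt_0_iff)
  note cliques = finite_directions disj ne commuting_graph_PSL2
  show "L_spec (commuting_graph (PSL TYPE('a) 2)) =
           S (\<lambda>n. add_mset 0 (replicate_mset (n - 1) (of_nat n)))"
    unfolding S_def sum_cliques[symmetric] using cliques_spec(1)[OF cliques] by (simp only: card_C)
  show "Q_spec (commuting_graph (PSL TYPE('a) 2)) =
           S (\<lambda>n. add_mset (2 * of_nat n - 2) (replicate_mset (n - 1) (of_nat n - 2)))"
    unfolding S_def sum_cliques[symmetric] using cliques_spec(2)[OF cliques] by (simp only: card_C)
qed

end

section \<open>The spectra for \<open>q = 2 ^ k\<close>\<close>

theorem proposition2p11:
  fixes k :: nat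
  assumes "k \<ge> 2"
    and "card (UNIV :: 'a :: field set) = 2 ^ k"
  shows "L_spec (commuting_graph (PSL TYPE('a) 2)) =
           replicate_mset (2 ^ (2 * k) + 2 ^ k + 1) 0 +
           replicate_mset (2 ^ (2 * k) - 2 ^ k - 2) (2 ^ k - 1) +
           replicate_mset (2 ^ (k - 1) * (2 ^ (2 * k) - 2 ^ (k + 1) - 3)) (2 ^ k - 2) +
           replicate_mset (2 ^ (k - 1) * (2 ^ (2 * k) - 2 ^ (k + 1) + 1)) (2 ^ k) \<and>
         Q_spec (commuting_graph (PSL TYPE('a) 2)) =
           replicate_mset (2 ^ k + 1) (2 ^ (k + 1) - 4) +
           replicate_mset (2 ^ (2 * k) - 2 ^ k - 2) (2 ^ k - 3) +
           replicate_mset (2 ^ (k - 1) * (2 ^ k + 1)) (2 ^ (k + 1) - 6) +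
           replicate_mset (2 ^ (k - 1) * (2 ^ (2 * k) - 2 ^ (k + 1) - 3)) (2 ^ k - 4) +
           replicate_mset (2 ^ (k - 1) * (2 ^ k - 1)) (2 ^ (k + 1) - 2) +
           replicate_mset (2 ^ (k - 1) * (2 ^ (2 * k) - 2 ^ (k + 1) + 1)) (2 ^ k - 2)"
proof -
  define p :: nat where "p = 2 ^ (k - 1)"
  define q :: nat where "q = 2 ^ k"
  have qp: "q = 2 * p" and p: "p \<ge> 2"
  proof -
    obtain m where "k = Suc (Suc m)" using assms(1) by (metis add_2_eq_Suc le_Suc_ex)
    then show "q = 2 * p" "p \<ge> 2" by (simp_all add: q_def p_def)
  qed
  have pows: "2 ^ (k - 1) = p" "2 ^ k = q" "2 ^ (k + 1) = 2 * q" "2 ^ (2 * k) = q * q"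
    "(2 :: complex) ^ k = of_nat q" "(2 :: complex) ^ (k + 1) = 2 * of_nat q"
    unfolding p_def q_def by (simp_all add: power_even_eq power2_eq_square)
  have finite: "finite (UNIV :: 'a set)"
    by (rule card_ge_0_finite) (simp add: assms(2))
  \<comment> \<open>Translation by 1 permutes the field, so summing all elements shows that the
    field order, a power of 2, is zero in the field; hence the characteristic is 2.\<close>
  have sum: "(\<Sum>x\<in>UNIV. x) = (\<Sum>x\<in>UNIV. x + (1 :: 'a))"
    by (rule sum.reindex_bij_witness[of _ "\<lambda>x. x + 1" "\<lambda>x. x - 1"]) auto
  have "(\<Sum>x\<in>UNIV. x :: 'a) = (\<Sum>x\<in>UNIV. x) + of_nat (2 ^ k)"
    by (subst (1) sum) (simp add: sum.distrib assms(2))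
  then have "(2 :: 'a) ^ k = 0"
    by (metis add_cancel_right_right of_nat_numeral of_nat_power)
  then have two: "(2 :: 'a) = 0"
    by (metis power_not_zero)
  interpret finite_field_char2 q "TYPE('a)"
    by unfold_locales (simp_all add: finite two assms(2) q_def)
  have half: "q * (q + 1) div 2 = p * (q + 1)" "q * (q - 1) div 2 = p * (q - 1)"
    by (simp_all only: qp mult.assoc nonzero_mult_div_cancel_left[OF zero_neq_numeral[symmetric]])
  have q3: "q > 2" using p by (simp add: qp)
  \<comment> \<open>The first three right-hand sides, the last two after multiplication by
    \<open>p\<close>, are the number of cliques of one size times that size minus 1. The fourth is
    the total number of cliques, which is the multiplicity of the Laplacian eigenvalue 0.\<close>
  have mult: "q * q - q - 2 = (q + 1) * (q - 1 - 1)"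
    "q * q - 2 * q - 3 = (q + 1) * (q - 2 - 1)"
    "q * q - 2 * q + 1 = (q - 1) * (q - 1)"
    "q * q + q + 1 = (q + 1) + p * (q + 1) + p * (q - 1)"
  proof -
    \<comment> \<open>Substituting \<open>r + 3\<close> resolves the truncated subtractions on the
      natural numbers.\<close>
    obtain r where r: "q = r + 3"
      using q3 by (metis Suc_leI add.commute le_Suc_ex numeral_3_eq_3 numeral_2_eq_2)
    show "q * q - q - 2 = (q + 1) * (q - 1 - 1)" "q * q - 2 * q - 3 = (q + 1) * (q - 2 - 1)"
      "q * q - 2 * q + 1 = (q - 1) * (q - 1)"
      by (simp_all add: r algebra_simps)
    have "p * (q + 1) + p * (q - 1) = p * ((q + 1) + (q - 1))"
      by (rule distrib_left[symmetric])
    also have "\<dots> = q * q"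
      using q3 by (simp add: qp)
    finally show "q * q + q + 1 = (q + 1) + p * (q + 1) + p * (q - 1)" by simp
  qed
  have val: "of_nat (q - 1) = (of_nat q - 1 :: complex)" "of_nat (q - 2) = (of_nat q - 2 :: complex)"
    "2 * (of_nat q - 1) - 2 = (2 * of_nat q - 4 :: complex)"
    "2 * (of_nat q - 2) - 2 = (2 * of_nat q - 6 :: complex)"
    "of_nat q - 1 - 2 = (of_nat q - 3 :: complex)" "of_nat q - 2 - 2 = (of_nat q - 4 :: complex)"
    using q3 by (simp_all add: of_nat_diff)
  have rep: "replicate_mset (l + m + n) x = replicate_mset l x + replicate_mset m x + replicate_mset n x"
    "repeat_mset n (add_mset x (replicate_mset m y)) = replicate_mset n x + replicate_mset (n * m) y"
    for l m n and x y :: complex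
    by (auto intro!: multiset_eqI)
  have "L_spec (commuting_graph (PSL TYPE('a) 2)) =
      replicate_mset (q + 1 + p * (q + 1) + p * (q - 1)) 0 +
      replicate_mset ((q + 1) * (q - 1 - 1)) (of_nat q - 1) +
      replicate_mset (p * ((q + 1) * (q - 2 - 1))) (of_nat q - 2) +
      replicate_mset (p * ((q - 1) * (q - 1))) (of_nat q)"
    unfolding spec_PSL2[OF q3] half rep val by (simp only: mult.assoc add_ac)
  moreover have "Q_spec (commuting_graph (PSL TYPE('a) 2)) =
      replicate_mset (q + 1) (2 * of_nat q - 4) +
      replicate_mset ((q + 1) * (q - 1 - 1)) (of_nat q - 3) +
      replicate_mset (p * (q + 1)) (2 * of_nat q - 6) +
      replicate_mset (p * ((q + 1) * (q - 2 - 1))) (of_nat q - 4) +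
      replicate_mset (p * (q - 1)) (2 * of_nat q - 2) +
      replicate_mset (p * ((q - 1) * (q - 1))) (of_nat q - 2)"
    unfolding spec_PSL2[OF q3] half rep val by (simp only: mult.assoc add_ac)
  ultimately show ?thesis
    unfolding pows mult by blast
qed

end
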